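(* The monoid $\mathcal{RM}^{\mathsf{fin}}_2$ is finitely generated. Moreover, $\mathcal{RM}^{\mathsf{fin}}_2$ has a finite generating set consisting of normal elements.
   Context: A prefix code over $\{0,1\}$ is a set of strings none of which is a proper prefix of another. A right ideal of $\{0,1\}^*$ is a set $R$ with $R=R\{0,1\}^*$; it equals $P\{0,1\}^*$ for a unique prefix code $P$. A right-ideal morphism is a partial function $f:\{0,1\}^*\to\{0,1\}^*$ whose domain $\mathrm{Dom}(f)$ is a right ideal and such that $f(xu)=f(x)u$ for all $x\in\mathrm{Dom}(f)$, $u\in\{0,1\}^*$; then $\mathrm{Im}(f)$ is a right ideal. $\mathrm{domC}(f)$ and $\mathrm{imC}(f)$ are the prefix codes of $\mathrm{Dom}(f)$ and $\mathrm{Im}(f)$. $\mathcal{RM}^{\mathsf{fin}}_2$ is the monoid, under composition, of all right-ideal morphisms of $\{0,1\}^*$ with finite domain code. A right-ideal morphism $f$ is normal if $f(\mathrm{domC}(f))=\mathrm{imC}(f)$. *)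

theory Defs
  imports "HOL-Algebra.Group" "HOL-Library.Sublist"
begin

text \<open>
  The free monoid \<open>{0,1}\<^sup>*\<close> is the type \<^typ>\<open>bool list\<close>; partial functions on it are
  maps \<^typ>\<open>bool list \<rightharpoonup> bool list\<close>, whose domain is \<^term>\<open>dom f\<close> and whose image
  is \<^term>\<open>ran f\<close>.
\<close>

section \<open>Prefix codes and right ideals\<close>

definition prefix_code :: "bool list set \<Rightarrow> bool" where
  "prefix_code P \<longleftrightarrow> (\<forall>p\<in>P. \<forall>q\<in>P. \<not> strict_prefix p q)"

text \<open>\<^term>\<open>ideal_gen P\<close> is \<open>P {0,1}\<^sup>*\<close>.\<close>

definition ideal_gen :: "bool list set \<Rightarrow> bool list set" where
  "ideal_gen P = {p @ u | p u. p \<in> P}"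

text \<open>The empty set is a right ideal, with the empty prefix code.\<close>

definition right_ideal :: "bool list set \<Rightarrow> bool" where
  "right_ideal R \<longleftrightarrow> R = ideal_gen R"

definition ideal_code :: "bool list set \<Rightarrow> bool list set" where
  "ideal_code R = (THE P. prefix_code P \<and> R = ideal_gen P)"

lemma ideal_genI: "p \<in> P \<Longrightarrow> p @ u \<in> ideal_gen P"
  unfolding ideal_gen_def by blast

lemma ideal_gen_self: "p \<in> P \<Longrightarrow> p \<in> ideal_gen P"
  using ideal_genI[of p P "[]"] by simp

lemma ideal_genE:
  assumes "x \<in> ideal_gen P"
  obtains p u where "p \<in> P" "x = p @ u"
  using assms unfolding ideal_gen_def by blast

lemma right_ideal_iff: "right_ideal R \<longleftrightarrow> (\<forall>x\<in>R. \<forall>u. x @ u \<in> R)"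
proof
  assume "right_ideal R"
  then have eq: "ideal_gen R = R" unfolding right_ideal_def by (rule sym)
  show "\<forall>x\<in>R. \<forall>u. x @ u \<in> R"
    by (intro ballI allI) (rule ideal_genI[where P = R, unfolded eq])
next
  assume *: "\<forall>x\<in>R. \<forall>u. x @ u \<in> R"
  have "R \<subseteq> ideal_gen R" by (rule subsetI) (rule ideal_gen_self)
  moreover have "ideal_gen R \<subseteq> R"
  proof
    fix x assume "x \<in> ideal_gen R"
    then obtain p u where "p \<in> R" "x = p @ u" by (rule ideal_genE)
    with * show "x \<in> R" by simp
  qed
  ultimately show "right_ideal R" unfolding right_ideal_def by (rule equalityI)
qed

lemma prefix_code_ideal_gen_minimal:
  assumes "prefix_code P"
  shows "P = {x \<in> ideal_gen P. \<forall>y \<in> ideal_gen P. \<not> strict_prefix y x}"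
proof (intro equalityI subsetI)
  fix x assume x: "x \<in> P"
  have "\<not> strict_prefix (p @ u) x" if "p \<in> P" for p u
  proof
    assume "strict_prefix (p @ u) x"
    then have "strict_prefix p x" by (auto simp: strict_prefix_def prefix_def)
    with assms x that show False unfolding prefix_code_def by blast
  qed
  moreover have "x \<in> ideal_gen P"
    using x by (rule ideal_gen_self)
  ultimately show "x \<in> {x \<in> ideal_gen P. \<forall>y \<in> ideal_gen P. \<not> strict_prefix y x}"
    by (blast elim: ideal_genE)
next
  fix x assume "x \<in> {x \<in> ideal_gen P. \<forall>y \<in> ideal_gen P. \<not> strict_prefix y x}"
  then have x: "x \<in> ideal_gen P" and min: "\<And>y. y \<in> ideal_gen P \<Longrightarrow> \<not> strict_prefix y x"
    by auto
  from x obtain p u where p: "p \<in> P" "x = p @ u" by (rule ideal_genE)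
  have "p \<in> ideal_gen P" using p(1) by (rule ideal_gen_self)
  with min have "\<not> strict_prefix p x" by blast
  with p show "x \<in> P" by (auto simp: strict_prefix_def)
qed

lemma right_ideal_ex1_prefix_code:
  assumes "right_ideal R"
  shows "\<exists>!P. prefix_code P \<and> R = ideal_gen P"
proof (rule ex_ex1I)
  let ?P = "{x \<in> R. \<forall>y \<in> R. \<not> strict_prefix y x}"
  have closed: "x @ u \<in> R" if "x \<in> R" for x u
    using assms that by (simp add: right_ideal_iff)
  have "x \<in> ideal_gen ?P" if "x \<in> R" for x
    using that
  proof (induction "length x" arbitrary: x rule: less_induct)
    case less
    show ?case
    proof (cases "x \<in> ?P")
      case True
      then show ?thesis by (rule ideal_gen_self)
    next
      case False
      with less.prems obtain y where y: "y \<in> R" "strict_prefix y x" by blast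
      then have "y \<in> ideal_gen ?P" using less.hyps prefix_length_less by blast
      then obtain p v where p: "p \<in> ?P" "y = p @ v" by (rule ideal_genE)
      from y(2) obtain u where "x = y @ u" by (auto simp: strict_prefix_def prefix_def)
      with p(2) have x: "x = p @ (v @ u)" by simp
      show ?thesis unfolding x using p(1) by (rule ideal_genI)
    qed
  qed
  moreover have "ideal_gen ?P \<subseteq> R" using closed by (auto elim: ideal_genE)
  ultimately have "R = ideal_gen ?P" by (intro equalityI subsetI) auto
  moreover have "prefix_code ?P" unfolding prefix_code_def by blast
  ultimately show "\<exists>P. prefix_code P \<and> R = ideal_gen P" by blast
next
  fix P Q
  assume "prefix_code P \<and> R = ideal_gen P" "prefix_code Q \<and> R = ideal_gen Q"
  then have P: "prefix_code P" and Q: "prefix_code Q" and eq: "ideal_gen P = ideal_gen Q"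
    by simp_all
  show "P = Q"
    by (rule trans[OF prefix_code_ideal_gen_minimal[OF P, unfolded eq]
          prefix_code_ideal_gen_minimal[OF Q, symmetric]])
qed

lemma ideal_code:
  assumes "right_ideal R"
  shows "prefix_code (ideal_code R)" and "ideal_gen (ideal_code R) = R"
proof -
  have *: "prefix_code (ideal_code R) \<and> R = ideal_gen (ideal_code R)"
    unfolding ideal_code_def by (rule theI'[OF right_ideal_ex1_prefix_code[OF assms]])
  show "prefix_code (ideal_code R)" by (rule conjunct1[OF *])
  show "ideal_gen (ideal_code R) = R" by (rule conjunct2[OF *, symmetric])
qed

lemma ideal_code_minimal:
  assumes "right_ideal R"
  shows "ideal_code R = {x \<in> R. \<forall>y \<in> R. \<not> strict_prefix y x}"
  by (rule prefix_code_ideal_gen_minimal[OF ideal_code(1)[OF assms], unfolded ideal_code(2)[OF assms]])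

section \<open>Right-ideal morphisms\<close>

definition right_ideal_morphism :: "(bool list \<rightharpoonup> bool list) \<Rightarrow> bool" where
  "right_ideal_morphism f \<longleftrightarrow>
     right_ideal (dom f) \<and> (\<forall>x\<in>dom f. \<forall>u. f (x @ u) = Some (the (f x) @ u))"

definition domC :: "(bool list \<rightharpoonup> bool list) \<Rightarrow> bool list set" where
  "domC f = ideal_code (dom f)"

definition imC :: "(bool list \<rightharpoonup> bool list) \<Rightarrow> bool list set" where
  "imC f = ideal_code (ran f)"

lemma right_ideal_morphism_ran:
  assumes "right_ideal_morphism f"
  shows "right_ideal (ran f)"
proof -
  have "y @ u \<in> ran f" if "y \<in> ran f" for y u
  proof -
    from that obtain x where "f x = Some y" unfolding ran_def by blast
    then have "f (x @ u) = Some (y @ u)"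
      using assms unfolding right_ideal_morphism_def by (metis domI option.sel)
    then show ?thesis unfolding ran_def by blast
  qed
  then show ?thesis unfolding right_ideal_iff by blast
qed

definition normal_morphism :: "(bool list \<rightharpoonup> bool list) \<Rightarrow> bool" where
  "normal_morphism f \<longleftrightarrow> (\<lambda>x. the (f x)) ` domC f = imC f"

definition RM_fin :: "(bool list \<rightharpoonup> bool list) monoid" where
  "RM_fin = \<lparr>carrier = {f. right_ideal_morphism f \<and> finite (domC f)},
             mult = (\<circ>\<^sub>m), one = Some\<rparr>"

lemma right_ideal_morphism_comp:
  assumes f: "right_ideal_morphism f" and g: "right_ideal_morphism g"
  shows "right_ideal_morphism (g \<circ>\<^sub>m f)"
proof -
  have *: "(g \<circ>\<^sub>m f) (x @ u) = Some (z @ u)" if "(g \<circ>\<^sub>m f) x = Some z" for x u z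
  proof -
    from that obtain y where "f x = Some y" "g y = Some z"
      by (auto simp: map_comp_Some_iff)
    then have "f (x @ u) = Some (y @ u)" "g (y @ u) = Some (z @ u)"
      using f g unfolding right_ideal_morphism_def by (force simp: dom_def)+
    then show ?thesis by (simp add: map_comp_def)
  qed
  show ?thesis
    unfolding right_ideal_morphism_def right_ideal_iff
  proof (intro conjI ballI allI)
    fix x u assume "x \<in> dom (g \<circ>\<^sub>m f)"
    then obtain z where z: "(g \<circ>\<^sub>m f) x = Some z" by blast
    show "(g \<circ>\<^sub>m f) (x @ u) = Some (the ((g \<circ>\<^sub>m f) x) @ u)"
      using *[OF z, of u] z by simp
    show "x @ u \<in> dom (g \<circ>\<^sub>m f)" using *[OF z, of u] by (rule domI)
  qed
qed

lemma finite_domC_comp: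
  assumes f: "right_ideal_morphism f" "finite (domC f)"
    and g: "right_ideal_morphism g" "finite (domC g)"
  shows "finite (domC (g \<circ>\<^sub>m f))"
proof -
  let ?h = "g \<circ>\<^sub>m f"
  let ?S = "domC f \<union> (\<Union>p\<in>domC f. \<Union>q\<in>domC g. (\<lambda>n. p @ drop n q) ` {..length q})"
  have rf: "right_ideal (dom f)" and rg: "right_ideal (dom g)"
    using f g unfolding right_ideal_morphism_def by auto
  have rh: "right_ideal (dom ?h)"
    using right_ideal_morphism_comp[OF f(1) g(1)] unfolding right_ideal_morphism_def by simp
  have fapp: "f (x @ u) = Some (y @ u)" if "f x = Some y" for x y u
    using f(1) that unfolding right_ideal_morphism_def by (metis domI option.sel)
  have "domC ?h \<subseteq> ?S"
  proof
    fix w assume "w \<in> domC ?h"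
    then have wh: "w \<in> dom ?h" and wmin: "\<And>y. y \<in> dom ?h \<Longrightarrow> \<not> strict_prefix y w"
      unfolding domC_def ideal_code_minimal[OF rh] by auto
    from wh have "w \<in> dom f" by (auto simp: map_comp_Some_iff)
    then obtain p u where p: "p \<in> domC f" and w: "w = p @ u"
      using ideal_code(2)[OF rf] unfolding domC_def by (blast elim: ideal_genE)
    have "p \<in> dom f" using p unfolding domC_def ideal_code_minimal[OF rf] by simp
    then obtain y where y: "f p = Some y" by blast
    show "w \<in> ?S"
    proof (cases "u = []")
      case True
      then show ?thesis using p w by simp
    next
      case False
      have "y @ u \<in> dom g" using wh fapp[OF y, of u] w by (auto simp: map_comp_Some_iff)
      then obtain q v where q: "q \<in> domC g" and yu: "y @ u = q @ v"
        using ideal_code(2)[OF rg] unfolding domC_def by (blast elim: ideal_genE)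
      have qg: "q \<in> dom g" using q unfolding domC_def ideal_code_minimal[OF rg] by simp
      have "v = []"
      proof (rule ccontr)
        assume v: "v \<noteq> []"
        then have eq: "y @ butlast u = q @ butlast v"
          using False yu by (metis butlast_append)
        have "q @ butlast v \<in> dom g" using qg rg unfolding right_ideal_iff by blast
        then have "p @ butlast u \<in> dom ?h"
          using fapp[OF y, of "butlast u"] eq by (auto simp: map_comp_def)
        moreover have "strict_prefix (p @ butlast u) w"
          using False w
          by (cases u rule: rev_cases) (auto simp: strict_prefix_def)
        ultimately show False using wmin by blast
      qed
      with yu have "q = y @ u" by simp
      with w have "w = p @ drop (length y) q" "length y \<le> length q" by simp_all
      then show ?thesis using p q by blast
    qed
  qed
  moreover have "finite ?S" using f(2) g(2) by blast
  ultimately show ?thesis by (rule finite_subset)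
qed

lemma Some_in_RM_fin: "Some \<in> carrier RM_fin"
proof -
  have r: "right_ideal (dom (Some :: bool list \<rightharpoonup> bool list))"
    unfolding right_ideal_iff by auto
  have "domC Some \<subseteq> {[]}"
    unfolding domC_def ideal_code_minimal[OF r] by (auto simp: strict_prefix_def dest: spec[of _ "[]"])
  then have "finite (domC Some)" by (rule finite_subset) simp
  then show ?thesis using r unfolding RM_fin_def right_ideal_morphism_def by simp
qed

lemma monoid_RM_fin: "monoid RM_fin"
proof (rule monoidI)
  show "x \<otimes>\<^bsub>RM_fin\<^esub> y \<in> carrier RM_fin" if "x \<in> carrier RM_fin" "y \<in> carrier RM_fin" for x y
    using that right_ideal_morphism_comp finite_domC_comp unfolding RM_fin_def by simp
  show "\<one>\<^bsub>RM_fin\<^esub> \<in> carrier RM_fin" using Some_in_RM_fin unfolding RM_fin_def by simp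
qed (auto simp: RM_fin_def map_comp_def fun_eq_iff split: option.split)

section \<open>Finite generation of monoids\<close>

inductive_set monoid_generate :: "('a, 'b) monoid_scheme \<Rightarrow> 'a set \<Rightarrow> 'a set"
  for M and A where
  one: "\<one>\<^bsub>M\<^esub> \<in> monoid_generate M A"
| incl: "a \<in> A \<Longrightarrow> a \<in> monoid_generate M A"
| mult: "a \<in> monoid_generate M A \<Longrightarrow> b \<in> monoid_generate M A \<Longrightarrow>
    a \<otimes>\<^bsub>M\<^esub> b \<in> monoid_generate M A"

definition finite_generating_set :: "('a, 'b) monoid_scheme \<Rightarrow> 'a set \<Rightarrow> bool" where
  "finite_generating_set M A \<longleftrightarrow>
     finite A \<and> A \<subseteq> carrier M \<and> monoid_generate M A = carrier M"

definition finitely_generated_monoid :: "('a, 'b) monoid_scheme \<Rightarrow> bool" where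
  "finitely_generated_monoid M \<longleftrightarrow> monoid M \<and> (\<exists>A. finite_generating_set M A)"

end

theory Submission
  imports Defs
begin

text \<open>
  Write \<open>0\<close> for \<^term>\<open>False\<close> and \<open>1\<close> for \<^term>\<open>True\<close>. A morphism whose domain contains the empty
  word is left concatenation by a fixed word; any other one is determined by its two restrictions
  to words starting with \<open>0\<close> and with \<open>1\<close>, and the domain codes of these restrictions consist of
  shorter words. Hence every element of \<^term>\<open>RM_fin\<close> is built from the empty map and from left
  concatenations by finitely many uses of the operation \<open>branch f g\<close>, which sends \<open>0x\<close> to \<open>f x\<close>
  and \<open>1x\<close> to \<open>g x\<close> (\<open>RM_fin_induct\<close>). It remains to find a finite set whose generated
  submonoid is closed under branching.

  Let \<open>f \<oplus> g\<close> send \<open>0x\<close> to \<open>0 f(x)\<close> and \<open>1x\<close> to \<open>1 g(x)\<close>, and let \<open>fold\<close> delete the first letter.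
  Then \<open>branch f g = fold (f \<oplus> id) (id \<oplus> g)\<close>, and \<open>id \<oplus> g\<close> is the conjugate of \<open>g \<oplus> id\<close> by the
  exchange of \<open>0\<close> and \<open>1\<close> as first letters. So closure under \<open>f \<mapsto> f \<oplus> id\<close> is enough.
  This map preserves products, so it suffices that it sends generators into the generated monoid.
  Start from a finite set \<open>B\<close> of maps and take as generators \<open>B\<close> together with all \<open>a \<oplus> id\<close> for
  \<open>a \<in> B\<close>. The only products left to find are \<open>(a \<oplus> id) \<oplus> id\<close>, in which \<open>a\<close> acts behind
  the prefix \<open>00\<close>. Let \<open>c\<close> re-associate the three pieces \<open>00, 01, 1\<close> into \<open>0, 10, 11\<close>. Then
  \<open>(a \<oplus> id) \<oplus> id = c\<inverse> (a \<oplus> id) c\<close>, with exactly the same domain because the domain code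
  of \<open>c\<close> is \<open>{00, 01, 1}\<close>. Putting \<open>c\<close> and \<open>c\<inverse>\<close> into \<open>B\<close> closes the argument.

  Every map in \<open>B\<close> visibly carries its domain code to a prefix code, hence is normal, and normality
  passes from \<open>a\<close> to \<open>a \<oplus> id\<close>.
\<close>

section \<open>Computing codes\<close>

lemma ideal_code_eqI:
  assumes "prefix_code P" "R = ideal_gen P"
  shows "ideal_code R = P"
proof -
  have "right_ideal R"
    unfolding right_ideal_iff assms(2) by (auto elim!: ideal_genE intro: ideal_genI)
  from right_ideal_ex1_prefix_code[OF this] show ?thesis
    unfolding ideal_code_def using assms by (intro the1_equality) auto
qed

lemma domC_props:
  assumes "right_ideal_morphism f"
  shows "prefix_code (domC f)" "ideal_gen (domC f) = dom f" "domC f \<subseteq> dom f"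
proof -
  have r: "right_ideal (dom f)" using assms unfolding right_ideal_morphism_def by simp
  show "prefix_code (domC f)" "ideal_gen (domC f) = dom f"
    using ideal_code[OF r] unfolding domC_def by simp_all
  then show "domC f \<subseteq> dom f" using ideal_gen_self by blast
qed

lemma right_ideal_morphism_append:
  assumes "right_ideal_morphism f" "f x = Some y"
  shows "f (x @ u) = Some (y @ u)"
  using assms unfolding right_ideal_morphism_def by (metis domI option.sel)

lemma right_ideal_morphismI:
  assumes "\<And>x y u. f x = Some y \<Longrightarrow> f (x @ u) = Some (y @ u)"
  shows "right_ideal_morphism f"
  unfolding right_ideal_morphism_def right_ideal_iff
  using assms by (auto simp: dom_def)

text \<open>
  The image of the domain code always generates the image ideal; being a prefix code is thus all
  that can fail.
\<close>

lemma normal_morphism_iff_prefix_code: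
  assumes f: "right_ideal_morphism f"
  shows "normal_morphism f \<longleftrightarrow> prefix_code ((\<lambda>x. the (f x)) ` domC f)" (is "_ \<longleftrightarrow> prefix_code ?Q")
proof
  assume "normal_morphism f"
  then show "prefix_code ?Q"
    unfolding normal_morphism_def imC_def
    using ideal_code(1)[OF right_ideal_morphism_ran[OF f]] by simp
next
  assume Q: "prefix_code ?Q"
  have "ran f = ideal_gen ?Q"
  proof (intro equalityI subsetI)
    fix y assume "y \<in> ran f"
    then obtain x where x: "f x = Some y" unfolding ran_def by blast
    then have "x \<in> ideal_gen (domC f)" using domC_props(2)[OF f] by blast
    then obtain p u where p: "p \<in> domC f" "x = p @ u" by (rule ideal_genE)
    then obtain z where z: "f p = Some z" using domC_props(3)[OF f] by blast
    have "y = z @ u" using right_ideal_morphism_append[OF f z, of u] x p(2) by simp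
    moreover have "z \<in> ?Q" using p(1) z by force
    ultimately show "y \<in> ideal_gen ?Q" by (simp add: ideal_genI)
  next
    fix y assume "y \<in> ideal_gen ?Q"
    then obtain p u where p: "p \<in> domC f" "y = the (f p) @ u" by (auto elim: ideal_genE)
    then obtain z where z: "f p = Some z" using domC_props(3)[OF f] by blast
    have "f (p @ u) = Some y" using right_ideal_morphism_append[OF f z] p(2) z by simp
    then show "y \<in> ran f" by (rule ranI)
  qed
  then show "normal_morphism f"
    unfolding normal_morphism_def imC_def using ideal_code_eqI[OF Q] by simp
qed

lemma ideal_gen_Un: "ideal_gen (P \<union> Q) = ideal_gen P \<union> ideal_gen Q"
  unfolding ideal_gen_def by auto

lemma ideal_gen_image_Cons: "ideal_gen (Cons b ` P) = Cons b ` ideal_gen P"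
proof
  show "ideal_gen (Cons b ` P) \<subseteq> Cons b ` ideal_gen P"
    by (auto elim!: ideal_genE intro: ideal_genI)
  show "Cons b ` ideal_gen P \<subseteq> ideal_gen (Cons b ` P)"
  proof
    fix x assume "x \<in> Cons b ` ideal_gen P"
    then obtain y where y: "y \<in> ideal_gen P" "x = b # y" by blast
    from y(1) obtain p u where "p \<in> P" "y = p @ u" by (rule ideal_genE)
    then show "x \<in> ideal_gen (Cons b ` P)"
      using ideal_genI[of "b # p" "Cons b ` P" u] y(2) by simp
  qed
qed

lemma prefix_code_Cons_Un:
  "prefix_code (Cons False ` P \<union> Cons True ` Q) \<longleftrightarrow> prefix_code P \<and> prefix_code Q"
  by (simp add: prefix_code_def ball_Un)

section \<open>Left concatenation and branching\<close>

definition left_concat :: "bool list \<Rightarrow> (bool list \<rightharpoonup> bool list)" where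
  "left_concat t x = Some (t @ x)"

fun branch ::
  "(bool list \<rightharpoonup> bool list) \<Rightarrow> (bool list \<rightharpoonup> bool list) \<Rightarrow> (bool list \<rightharpoonup> bool list)" where
  "branch f g [] = None"
| "branch f g (False # x) = f x"
| "branch f g (True # x) = g x"

definition direct_sum ::
  "(bool list \<rightharpoonup> bool list) \<Rightarrow> (bool list \<rightharpoonup> bool list) \<Rightarrow> (bool list \<rightharpoonup> bool list)"
  (infixr "\<oplus>\<^sub>m" 65) where
  "f \<oplus>\<^sub>m g = branch (left_concat [False] \<circ>\<^sub>m f) (left_concat [True] \<circ>\<^sub>m g)"

lemma left_concat_morphism: "right_ideal_morphism (left_concat t)"
  by (rule right_ideal_morphismI) (auto simp: left_concat_def)

lemma domC_left_concat: "domC (left_concat t) = {[]}"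
  unfolding domC_def
  by (rule ideal_code_eqI) (auto simp: prefix_code_def ideal_gen_def left_concat_def)

lemma empty_morphism: "right_ideal_morphism Map.empty"
  by (rule right_ideal_morphismI) simp

lemma domC_empty: "domC Map.empty = {}"
  unfolding domC_def by (rule ideal_code_eqI) (auto simp: prefix_code_def ideal_gen_def)

lemma branch_morphism:
  assumes "right_ideal_morphism f" "right_ideal_morphism g"
  shows "right_ideal_morphism (branch f g)"
proof (rule right_ideal_morphismI)
  fix x y u assume "branch f g x = Some y"
  then show "branch f g (x @ u) = Some (y @ u)"
    using right_ideal_morphism_append[OF assms(1)] right_ideal_morphism_append[OF assms(2)]
    by (induction f g x rule: branch.induct) auto
qed

lemma domC_branch:
  assumes f: "right_ideal_morphism f" and g: "right_ideal_morphism g"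
  shows "domC (branch f g) = Cons False ` domC f \<union> Cons True ` domC g" (is "_ = ?P")
proof -
  have "dom (branch f g) = Cons False ` dom f \<union> Cons True ` dom g"
  proof (rule Set.set_eqI)
    show "x \<in> dom (branch f g) \<longleftrightarrow> x \<in> Cons False ` dom f \<union> Cons True ` dom g" for x
      by (induction f g x rule: branch.induct) (auto simp: dom_def)
  qed
  also have "\<dots> = Cons False ` ideal_gen (domC f) \<union> Cons True ` ideal_gen (domC g)"
    using f g by (simp add: domC_props)
  also have "\<dots> = ideal_gen ?P"
    by (simp add: ideal_gen_Un ideal_gen_image_Cons)
  finally have "dom (branch f g) = ideal_gen ?P" .
  moreover have "prefix_code ?P"
    using f g by (simp add: prefix_code_Cons_Un domC_props)
  ultimately show ?thesis unfolding domC_def[of "branch f g"] by (rule ideal_code_eqI[rotated])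
qed

lemma carrier_RM_fin:
  "f \<in> carrier RM_fin \<longleftrightarrow> right_ideal_morphism f \<and> finite (domC f)"
  by (simp add: RM_fin_def)

lemma mult_RM_fin: "f \<otimes>\<^bsub>RM_fin\<^esub> g = f \<circ>\<^sub>m g"
  by (simp add: RM_fin_def)

lemma left_concat_in_RM_fin: "left_concat t \<in> carrier RM_fin"
  by (simp add: carrier_RM_fin left_concat_morphism domC_left_concat)

lemma empty_in_RM_fin: "Map.empty \<in> carrier RM_fin"
  by (simp add: carrier_RM_fin empty_morphism domC_empty)

lemma branch_in_RM_fin:
  "f \<in> carrier RM_fin \<Longrightarrow> g \<in> carrier RM_fin \<Longrightarrow> branch f g \<in> carrier RM_fin"
  by (simp add: carrier_RM_fin branch_morphism domC_branch)

lemma comp_in_RM_fin: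
  "f \<in> carrier RM_fin \<Longrightarrow> g \<in> carrier RM_fin \<Longrightarrow> f \<circ>\<^sub>m g \<in> carrier RM_fin"
  using monoid.m_closed[OF monoid_RM_fin] by (simp add: mult_RM_fin)

lemma direct_sum_in_RM_fin:
  "f \<in> carrier RM_fin \<Longrightarrow> g \<in> carrier RM_fin \<Longrightarrow> f \<oplus>\<^sub>m g \<in> carrier RM_fin"
  unfolding direct_sum_def
  by (intro branch_in_RM_fin comp_in_RM_fin left_concat_in_RM_fin)

text \<open>
  Left concatenation is total, so applying it afterwards cannot shrink the domain.
\<close>

lemma domC_left_concat_comp: "domC (left_concat t \<circ>\<^sub>m f) = domC f"
proof -
  have "dom (left_concat t \<circ>\<^sub>m f) = dom f"
    by (auto simp: dom_def map_comp_def left_concat_def split: option.splits)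
  then show ?thesis by (simp add: domC_def)
qed

lemma domC_direct_sum:
  assumes "right_ideal_morphism f" "right_ideal_morphism g"
  shows "domC (f \<oplus>\<^sub>m g) = Cons False ` domC f \<union> Cons True ` domC g"
  using assms unfolding direct_sum_def
  by (simp add: domC_branch right_ideal_morphism_comp left_concat_morphism domC_left_concat_comp)

lemma normal_direct_sum:
  assumes f: "right_ideal_morphism f" "normal_morphism f"
    and g: "right_ideal_morphism g" "normal_morphism g"
  shows "normal_morphism (f \<oplus>\<^sub>m g)"
proof -
  have "right_ideal_morphism (f \<oplus>\<^sub>m g)"
    unfolding direct_sum_def
    by (intro branch_morphism right_ideal_morphism_comp left_concat_morphism f g)
  moreover have "(\<lambda>x. the ((f \<oplus>\<^sub>m g) x)) ` domC (f \<oplus>\<^sub>m g) =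
      Cons False ` (\<lambda>x. the (f x)) ` domC f \<union> Cons True ` (\<lambda>x. the (g x)) ` domC g"
  proof -
    have "the ((f \<oplus>\<^sub>m g) (False # x)) = False # the (f x)" if "x \<in> domC f" for x
      using that domC_props(3)[OF f(1)]
      by (auto simp: direct_sum_def left_concat_def map_comp_def)
    moreover have "the ((f \<oplus>\<^sub>m g) (True # x)) = True # the (g x)" if "x \<in> domC g" for x
      using that domC_props(3)[OF g(1)]
      by (auto simp: direct_sum_def left_concat_def map_comp_def)
    ultimately show ?thesis
      unfolding domC_direct_sum[OF f(1) g(1)] image_Un image_image by simp
  qed
  ultimately show ?thesis
    using f g by (simp add: normal_morphism_iff_prefix_code prefix_code_Cons_Un)
qed

section \<open>Every morphism is a finite tree of branchings\<close>

lemma morphism_with_Nil_eq_left_concat: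
  assumes "right_ideal_morphism f" "f [] = Some t"
  shows "f = left_concat t"
  using right_ideal_morphism_append[OF assms] by (auto simp: left_concat_def)

lemma morphism_without_Nil_eq_branch:
  assumes f: "right_ideal_morphism f" and "f [] = None"
  obtains f0 f1 where "right_ideal_morphism f0" "right_ideal_morphism f1" "f = branch f0 f1"
proof
  show "right_ideal_morphism (\<lambda>x. f (False # x))"
    by (rule right_ideal_morphismI) (use right_ideal_morphism_append[OF f] in force)
  show "right_ideal_morphism (\<lambda>x. f (True # x))"
    by (rule right_ideal_morphismI) (use right_ideal_morphism_append[OF f] in force)
  show "f = branch (\<lambda>x. f (False # x)) (\<lambda>x. f (True # x))"
  proof
    show "f x = branch (\<lambda>x. f (False # x)) (\<lambda>x. f (True # x)) x" for x
      using assms(2) by (cases "(\<lambda>x. f (False # x), \<lambda>x. f (True # x), x)" rule: branch.cases) auto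
  qed
qed

text \<open>
  The induction is on a strict bound for the lengths of the words in the domain code, which drops by
  one in each branch; the bound \<open>0\<close> leaves only the empty map.
\<close>

lemma RM_fin_induct [consumes 1, case_names empty left_concat branch]:
  assumes "f \<in> carrier RM_fin"
    and empty: "P Map.empty"
    and left_concat: "\<And>t. P (left_concat t)"
    and branch: "\<And>f g. P f \<Longrightarrow> P g \<Longrightarrow> P (branch f g)"
  shows "P f"
proof -
  have bounded: "P f" if "right_ideal_morphism f" "\<forall>x\<in>domC f. length x < n" for f n
    using that
  proof (induction n arbitrary: f)
    case 0
    then have "domC f = {}" by auto
    then have "dom f = {}" using domC_props(2)[OF 0(1)] by (auto simp: ideal_gen_def)
    with empty show ?case by simp
  next
    case (Suc n)
    show ?case
    proof (cases "f []")
      case None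
      then obtain f0 f1 where f: "right_ideal_morphism f0" "right_ideal_morphism f1"
        "f = branch f0 f1"
        by (rule morphism_without_Nil_eq_branch[OF Suc.prems(1)])
      with Suc.prems(2) have "\<forall>x\<in>domC f0. length x < n" "\<forall>x\<in>domC f1. length x < n"
        by (simp_all add: domC_branch ball_Un)
      with f Suc.IH branch show ?thesis by simp
    next
      case (Some t)
      with left_concat show ?thesis
        using morphism_with_Nil_eq_left_concat[OF Suc.prems(1)] by metis
    qed
  qed
  from assms(1) have "finite (length ` domC f)" by (simp add: carrier_RM_fin)
  then have "\<forall>x\<in>domC f. length x < Suc (Max (length ` domC f))"
    by (simp add: less_Suc_eq_le)
  with bounded assms(1) show ?thesis by (simp add: carrier_RM_fin)
qed

section \<open>The generators\<close>

definition swap_map :: "bool list \<rightharpoonup> bool list" where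
  "swap_map = branch (left_concat [True]) (left_concat [False])"

definition fold_map :: "bool list \<rightharpoonup> bool list" where
  "fold_map = branch Some Some"

text \<open>
  The table \<open>00 \<mapsto> 0, 01 \<mapsto> 10, 1 \<mapsto> 11\<close>, and below it the inverse table. On infinite words
  they act, up to inversion, as the standard generator \<open>x\<^sub>0\<close> of Thompson's group \<open>F\<close>.
\<close>

definition assoc_map :: "bool list \<rightharpoonup> bool list" where
  "assoc_map = branch (branch (left_concat [False]) (left_concat [True, False]))
                      (left_concat [True, True])"

definition assoc_inv_map :: "bool list \<rightharpoonup> bool list" where
  "assoc_inv_map = branch (left_concat [False, False])
                          (branch (left_concat [False, True]) (left_concat [True]))"

definition base_maps :: "(bool list \<rightharpoonup> bool list) set" where
  "base_maps = {Map.empty, left_concat [], left_concat [False], left_concat [True],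
                swap_map, fold_map, assoc_map, assoc_inv_map}"

definition generators :: "(bool list \<rightharpoonup> bool list) set" where
  "generators = base_maps \<union> (\<lambda>a. a \<oplus>\<^sub>m Some) ` base_maps"

lemma left_concat_Nil: "left_concat [] = Some"
  by (auto simp: left_concat_def)

lemma base_maps_in_RM_fin: "base_maps \<subseteq> carrier RM_fin"
  unfolding base_maps_def swap_map_def fold_map_def assoc_map_def assoc_inv_map_def
  by (auto intro!: branch_in_RM_fin left_concat_in_RM_fin empty_in_RM_fin Some_in_RM_fin)

lemma generators_in_RM_fin: "generators \<subseteq> carrier RM_fin"
  unfolding generators_def
  using base_maps_in_RM_fin direct_sum_in_RM_fin Some_in_RM_fin by blast

lemma normal_base_maps:
  assumes "f \<in> base_maps"
  shows "normal_morphism f"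
proof -
  have "right_ideal_morphism f" using assms base_maps_in_RM_fin carrier_RM_fin by blast
  moreover have "prefix_code ((\<lambda>x. the (f x)) ` domC f)"
    using assms
    unfolding base_maps_def swap_map_def fold_map_def assoc_map_def assoc_inv_map_def
      left_concat_Nil[symmetric] insert_iff empty_iff
    by (elim disjE FalseE)
      (simp_all add: domC_branch domC_left_concat domC_empty branch_morphism
        left_concat_morphism left_concat_def prefix_code_def)
  ultimately show ?thesis by (simp add: normal_morphism_iff_prefix_code)
qed

lemma normal_generators:
  assumes "f \<in> generators"
  shows "normal_morphism f"
proof -
  have "Some \<in> base_maps" by (simp add: base_maps_def left_concat_Nil)
  moreover have "right_ideal_morphism a" if "a \<in> base_maps" for a
    using that base_maps_in_RM_fin carrier_RM_fin by blast
  ultimately show ?thesis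
    using assms unfolding generators_def by (auto intro: normal_base_maps normal_direct_sum)
qed

section \<open>Closure of the generated monoid under branching\<close>

lemma map_comp_direct_sum_id: "(f \<circ>\<^sub>m g) \<oplus>\<^sub>m Some = (f \<oplus>\<^sub>m Some) \<circ>\<^sub>m (g \<oplus>\<^sub>m Some)"
proof
  show "((f \<circ>\<^sub>m g) \<oplus>\<^sub>m Some) x = ((f \<oplus>\<^sub>m Some) \<circ>\<^sub>m (g \<oplus>\<^sub>m Some)) x" for x
    by (cases "(f, g, x)" rule: branch.cases)
      (auto simp: direct_sum_def map_comp_def left_concat_def split: option.splits)
qed

text \<open>
  Both sides are undefined on the empty word and on \<open>0\<close>, because \<open>assoc_map\<close> is; on all other words
  \<open>assoc_map\<close> shortens the prefix \<open>00\<close> to \<open>0\<close> and moves the words that must stay fixed behind a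
  single \<open>1\<close>, so that \<open>a \<oplus> id\<close> does the rest.
\<close>

lemma direct_sum_id_id_by_conjugation:
  "(a \<oplus>\<^sub>m Some) \<oplus>\<^sub>m Some = assoc_inv_map \<circ>\<^sub>m ((a \<oplus>\<^sub>m Some) \<circ>\<^sub>m assoc_map)"
proof
  fix x
  show "((a \<oplus>\<^sub>m Some) \<oplus>\<^sub>m Some) x = (assoc_inv_map \<circ>\<^sub>m ((a \<oplus>\<^sub>m Some) \<circ>\<^sub>m assoc_map)) x"
  proof (cases "(a, a, x)" rule: branch.cases)
    case (2 _ _ y)
    then show ?thesis
      by (cases "(a, a, y)" rule: branch.cases)
        (auto simp: direct_sum_def map_comp_def left_concat_def assoc_map_def assoc_inv_map_def
          split: option.splits)
  qed (auto simp: direct_sum_def map_comp_def left_concat_def assoc_map_def assoc_inv_map_def)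
qed

lemma id_direct_sum_by_conjugation:
  "Some \<oplus>\<^sub>m g = swap_map \<circ>\<^sub>m ((g \<oplus>\<^sub>m Some) \<circ>\<^sub>m swap_map)"
proof
  show "(Some \<oplus>\<^sub>m g) x = (swap_map \<circ>\<^sub>m ((g \<oplus>\<^sub>m Some) \<circ>\<^sub>m swap_map)) x" for x
    by (cases "(g, g, x)" rule: branch.cases)
      (auto simp: direct_sum_def map_comp_def left_concat_def swap_map_def split: option.splits)
qed

lemma branch_factorization:
  "branch f g = fold_map \<circ>\<^sub>m ((f \<oplus>\<^sub>m Some) \<circ>\<^sub>m (Some \<oplus>\<^sub>m g))"
proof
  show "branch f g x = (fold_map \<circ>\<^sub>m ((f \<oplus>\<^sub>m Some) \<circ>\<^sub>m (Some \<oplus>\<^sub>m g))) x" for x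
    by (cases "(f, g, x)" rule: branch.cases)
      (auto simp: direct_sum_def map_comp_def left_concat_def fold_map_def split: option.splits)
qed

lemma comp_in_generated:
  "f \<in> monoid_generate RM_fin A \<Longrightarrow> g \<in> monoid_generate RM_fin A \<Longrightarrow>
    f \<circ>\<^sub>m g \<in> monoid_generate RM_fin A"
  using monoid_generate.mult[of f RM_fin A g] by (simp add: mult_RM_fin)

lemma base_maps_generated: "a \<in> base_maps \<Longrightarrow> a \<in> monoid_generate RM_fin generators"
  by (rule monoid_generate.incl) (simp add: generators_def)

lemma base_direct_sum_id_generated:
  "a \<in> base_maps \<Longrightarrow> a \<oplus>\<^sub>m Some \<in> monoid_generate RM_fin generators"
  by (rule monoid_generate.incl) (simp add: generators_def)

lemma direct_sum_id_generated:
  assumes "f \<in> monoid_generate RM_fin generators"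
  shows "f \<oplus>\<^sub>m Some \<in> monoid_generate RM_fin generators"
  using assms
proof induction
  case one
  (* The sum of two identities is the identity on nonempty words, so it is not the unit of the
     monoid; the identity is therefore kept among the base maps. *)
  have "Some \<in> base_maps" by (simp add: base_maps_def left_concat_Nil)
  then show ?case using base_direct_sum_id_generated by (simp add: RM_fin_def)
next
  case (incl a)
  then consider "a \<in> base_maps" | b where "b \<in> base_maps" "a = b \<oplus>\<^sub>m Some"
    unfolding generators_def by blast
  then show ?case
  proof cases
    case 1
    then show ?thesis by (rule base_direct_sum_id_generated)
  next
    case 2
    have "assoc_map \<in> base_maps" "assoc_inv_map \<in> base_maps" by (simp_all add: base_maps_def)
    with 2 show ?thesis
      unfolding 2(2) direct_sum_id_id_by_conjugation
      by (intro comp_in_generated base_direct_sum_id_generated base_maps_generated)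
  qed
next
  case (mult a b)
  then show ?case by (simp add: mult_RM_fin map_comp_direct_sum_id comp_in_generated)
qed

lemma branch_generated:
  assumes "f \<in> monoid_generate RM_fin generators" "g \<in> monoid_generate RM_fin generators"
  shows "branch f g \<in> monoid_generate RM_fin generators"
proof -
  have "swap_map \<in> base_maps" "fold_map \<in> base_maps" by (simp_all add: base_maps_def)
  with assms show ?thesis
    unfolding branch_factorization id_direct_sum_by_conjugation
    by (auto intro!: comp_in_generated intro: direct_sum_id_generated base_maps_generated)
qed

lemma left_concat_generated: "left_concat t \<in> monoid_generate RM_fin generators"
proof (induction t)
  case Nil
  show ?case by (rule base_maps_generated) (simp add: base_maps_def)
next
  case (Cons b t)
  have "left_concat (b # t) = left_concat [b] \<circ>\<^sub>m left_concat t"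
    by (auto simp: left_concat_def map_comp_def)
  moreover have "left_concat [b] \<in> base_maps" by (cases b) (simp_all add: base_maps_def)
  ultimately show ?case using Cons.IH by (simp add: comp_in_generated base_maps_generated)
qed

section \<open>Finite generation by normal morphisms\<close>

lemma generators_generate: "finite_generating_set RM_fin generators"
proof -
  have "f \<in> carrier RM_fin" if "f \<in> monoid_generate RM_fin generators" for f
    using that
  proof induction
    case one
    show ?case by (rule monoid.one_closed[OF monoid_RM_fin])
  next
    case (incl a)
    then show ?case using generators_in_RM_fin by blast
  next
    case (mult a b)
    then show ?case by (intro monoid.m_closed[OF monoid_RM_fin])
  qed
  moreover have "f \<in> monoid_generate RM_fin generators" if "f \<in> carrier RM_fin" for f
    using that
  proof (induction rule: RM_fin_induct)
    case empty
    show ?case by (rule base_maps_generated) (simp add: base_maps_def)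
  qed (simp_all add: left_concat_generated branch_generated)
  moreover have "finite generators" by (simp add: generators_def base_maps_def)
  ultimately show ?thesis
    unfolding finite_generating_set_def using generators_in_RM_fin by blast
qed

theorem theorem5p6:
  shows "finitely_generated_monoid RM_fin \<and>
         (\<exists>A. finite_generating_set RM_fin A \<and> (\<forall>f\<in>A. normal_morphism f))"
proof (intro conjI exI ballI)
  show "finitely_generated_monoid RM_fin"
    unfolding finitely_generated_monoid_def
    using monoid_RM_fin generators_generate by blast
  show "finite_generating_set RM_fin generators" by (rule generators_generate)
  show "normal_morphism f" if "f \<in> generators" for f using that by (rule normal_generators)
qed

end
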